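(* Let $X$ be a Banach space. Then $$\frac{1}{3}K_{1}(X)\leqslant \mu^{s}(X)\leqslant \operatorname{bs}(X^{*}).$$
   Context: Banach spaces are infinite-dimensional, over the real or complex field; $B_X$ denotes the closed unit ball of $X$, and $\mathcal F_X$ the family of all weakly compact subsets of $B_X$. The family of all subsequences of $(x_n)_{n=1}^\infty$ is denoted $\mathrm{ss}((x_n)_{n=1}^\infty)$. A sequence $(y_n)_{n=1}^\infty$ is a convex block subsequence of $(x_n)_{n=1}^\infty$ if there is a strictly increasing sequence of positive integers $(k_n)_{n=1}^\infty$ such that, with $k_0=0$, $y_n\in\operatorname{conv}\{x_i: k_{n-1}+1\leqslant i\leqslant k_n\}$ for every $n\in\mathbb N$. The collection of all convex block subsequences of $(x_n)$ is denoted $\operatorname{cbs}((x_n)_{n=1}^\infty)$. For a bounded sequence $(f_n)_{n=1}^\infty$ in $X^*$ define $$\alpha((f_n)_{n=1}^\infty)=\sup_{K\in\mathcal F_X}\limsup_{n\to\infty}\sup_{x\in K}|\langle f_n,x\rangle|,\qquad c\alpha((f_n)_{n=1}^\infty)=\alpha\Big(\Big(\tfrac1n\sum_{i=1}^n f_i\Big)_{n=1}^\infty\Big).$$ Define $$K_1(X)=\sup_{(f_n)}\ \inf_{(g_n)\in\operatorname{cbs}((f_n))}\alpha((g_n)_{n=1}^\infty),\qquad \mu^s(X)=\sup_{(f_n)}\ \inf_{(g_n)\in\mathrm{ss}((f_n))}\ \sup_{(h_n)\in\mathrm{ss}((g_n))}c\alpha((h_n)_{n=1}^\infty),$$ where the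 outer suprema are over all weak$^*$ null sequences $(f_n)_{n=1}^\infty$ in $B_{X^*}$. For a bounded sequence $(x_n)_{n=1}^\infty$ in a Banach space set $\operatorname{ca}((x_n)_{n=1}^\infty)=\inf_{n\in\mathbb N}\sup_{k,l\geqslant n}\|x_k-x_l\|$ and $\mathrm{cca}((x_n)_{n=1}^\infty)=\operatorname{ca}\big((\frac1n\sum_{i=1}^n x_i)_{n=1}^\infty\big)$. For a Banach space $Y$ define $$\operatorname{bs}(Y)=\sup_{(x_n)_{n=1}^\infty\subseteq B_Y}\ \inf_{(y_n)\in\mathrm{ss}((x_n))}\ \sup_{(z_n)\in\mathrm{ss}((y_n))}\mathrm{cca}((z_n)_{n=1}^\infty).$$ *)

theory Defs
  imports "HOL-Analysis.Analysis"
begin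

text \<open>
  Real and complex Banach spaces are treated uniformly. By Frobenius' theorem, the fields of
  sort \<open>{real_normed_field, euclidean_space}\<close> are, up to isometric isomorphism, exactly
  the reals and the complex numbers. The type class \<open>banach\<close> provides a complete norm and
  real scalars; the parameter \<open>smul\<close> is the scalar multiplication over the field, which
  has to extend the real one.
\<close>

locale banach_space_over = vector_space smul
  for smul :: "'k::{real_normed_field,euclidean_space} \<Rightarrow> 'a::banach \<Rightarrow> 'a" +
  assumes smul_of_real: "smul (of_real r) x = r *\<^sub>R x"
    and norm_smul: "norm (smul c x) = norm c * norm x"

lemma banach_space_over_real:
  "banach_space_over (scaleR :: real \<Rightarrow> 'a::banach \<Rightarrow> 'a)"
  by unfold_locales (simp_all add: algebra_simps)

lemma banach_space_over_complex:
  "banach_space_over ((*) :: complex \<Rightarrow> complex \<Rightarrow> complex)"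
  by unfold_locales (simp_all add: algebra_simps norm_mult scaleR_conv_of_real)

definition infinite_dimensional :: "('k::field \<Rightarrow> 'a::ab_group_add \<Rightarrow> 'a) \<Rightarrow> bool" where
  "infinite_dimensional smul \<longleftrightarrow> (\<nexists>B. finite B \<and> module.span smul B = UNIV)"

text \<open>
  The dual space is the set of those bounded real-linear maps into the scalar field that are
  linear over the scalar field. Its norm is the operator norm of the ambient type.
\<close>

definition dual ::
  "('k::{real_normed_field,euclidean_space} \<Rightarrow> 'a::banach \<Rightarrow> 'a) \<Rightarrow> ('a \<Rightarrow>\<^sub>L 'k) set" where
  "dual smul = {f. \<forall>c x. blinfun_apply f (smul c x) = c * blinfun_apply f x}"

definition weak_topology ::
  "('k::{real_normed_field,euclidean_space} \<Rightarrow> 'a::banach \<Rightarrow> 'a) \<Rightarrow> 'a topology" where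
  "weak_topology smul =
     topology_generated_by {blinfun_apply f -` U | f U. f \<in> dual smul \<and> open U}"

definition weak_star_topology ::
  "('k::{real_normed_field,euclidean_space} \<Rightarrow> 'a::banach \<Rightarrow> 'a) \<Rightarrow> ('a \<Rightarrow>\<^sub>L 'k) topology" where
  "weak_star_topology smul =
     topology_generated_by {{f \<in> dual smul. blinfun_apply f x \<in> U} | x U. open U}"

definition weak_star_null ::
  "('k::{real_normed_field,euclidean_space} \<Rightarrow> 'a::banach \<Rightarrow> 'a) \<Rightarrow> (nat \<Rightarrow> 'a \<Rightarrow>\<^sub>L 'k) \<Rightarrow> bool" where
  "weak_star_null smul f \<longleftrightarrow> limitin (weak_star_topology smul) f 0 sequentially"

definition weakly_compact_subsets ::
  "('k::{real_normed_field,euclidean_space} \<Rightarrow> 'a::banach \<Rightarrow> 'a) \<Rightarrow> 'a set set" where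
  "weakly_compact_subsets smul = {K. K \<subseteq> cball 0 1 \<and> compactin (weak_topology smul) K}"

text \<open>
  Sequences are indexed from 0, so the entry with index \<open>n\<close> here is the entry with index
  \<open>n + 1\<close> of a sequence indexed by the positive integers. In particular the block
  \<open>{k n..<k (Suc n)}\<close> is the set of positive indices from \<open>k n + 1\<close> to
  \<open>k (Suc n)\<close>, and the mean at index \<open>n\<close> is that of \<open>n + 1\<close> terms.
\<close>

definition subsequences :: "(nat \<Rightarrow> 'b) \<Rightarrow> (nat \<Rightarrow> 'b) set" where
  "subsequences x = {x \<circ> r | r. strict_mono r}"

definition convex_block_subsequences :: "(nat \<Rightarrow> 'b::real_vector) \<Rightarrow> (nat \<Rightarrow> 'b) set" where
  "convex_block_subsequences x =
     {y. \<exists>k. strict_mono k \<and> k 0 = 0 \<and> (\<forall>n. y n \<in> convex hull (x ` {k n..<k (Suc n)}))}"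

definition cesaro :: "(nat \<Rightarrow> 'b::real_vector) \<Rightarrow> nat \<Rightarrow> 'b" where
  "cesaro x n = (1 / real (Suc n)) *\<^sub>R (\<Sum>i\<le>n. x i)"

text \<open>
  All quantities are nonnegative and take values in the complete lattice \<open>ennreal\<close>, where the
  supremum over the empty set (which is weakly compact) is 0.
\<close>

definition alpha ::
  "('k::{real_normed_field,euclidean_space} \<Rightarrow> 'a::banach \<Rightarrow> 'a) \<Rightarrow> (nat \<Rightarrow> 'a \<Rightarrow>\<^sub>L 'k) \<Rightarrow> ennreal"
  where
  "alpha smul f =
     (SUP K\<in>weakly_compact_subsets smul.
        limsup (\<lambda>n. SUP x\<in>K. ennreal (norm (blinfun_apply (f n) x))))"

definition c_alpha ::
  "('k::{real_normed_field,euclidean_space} \<Rightarrow> 'a::banach \<Rightarrow> 'a) \<Rightarrow> (nat \<Rightarrow> 'a \<Rightarrow>\<^sub>L 'k) \<Rightarrow> ennreal"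
  where
  "c_alpha smul f = alpha smul (cesaro f)"

definition weak_star_null_seqs ::
  "('k::{real_normed_field,euclidean_space} \<Rightarrow> 'a::banach \<Rightarrow> 'a) \<Rightarrow> (nat \<Rightarrow> 'a \<Rightarrow>\<^sub>L 'k) set" where
  "weak_star_null_seqs smul =
     {f. range f \<subseteq> dual smul \<inter> cball 0 1 \<and> weak_star_null smul f}"

definition K1 :: "('k::{real_normed_field,euclidean_space} \<Rightarrow> 'a::banach \<Rightarrow> 'a) \<Rightarrow> ennreal" where
  "K1 smul =
     (SUP f\<in>weak_star_null_seqs smul. INF g\<in>convex_block_subsequences f. alpha smul g)"

definition mu_s :: "('k::{real_normed_field,euclidean_space} \<Rightarrow> 'a::banach \<Rightarrow> 'a) \<Rightarrow> ennreal" where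
  "mu_s smul =
     (SUP f\<in>weak_star_null_seqs smul. INF g\<in>subsequences f. SUP h\<in>subsequences g. c_alpha smul h)"

definition ca :: "(nat \<Rightarrow> 'b::real_normed_vector) \<Rightarrow> ennreal" where
  "ca x = (INF n. SUP k\<in>{n..}. SUP l\<in>{n..}. ennreal (norm (x k - x l)))"

definition cca :: "(nat \<Rightarrow> 'b::real_normed_vector) \<Rightarrow> ennreal" where
  "cca x = ca (cesaro x)"

text \<open>
  The argument \<open>Y\<close> is a closed subspace of the ambient type, regarded as a Banach space in
  its own right; only the norm and the real scalars matter.
\<close>

definition bs :: "'b::real_normed_vector set \<Rightarrow> ennreal" where
  "bs Y = (SUP x\<in>{x. range x \<subseteq> Y \<inter> cball 0 1}. INF y\<in>subsequences x. SUP z\<in>subsequences y. cca z)"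

end

theory Submission
  imports Defs
begin

text \<open>
  For the upper bound, every term of a weak* null sequence of functionals is the pointwise limit of
  its differences with the later terms, so on the unit ball it is dominated by the oscillation of
  the tail.

  The lower bound holds even without the factor 1/3. Given a subsequence \<open>g\<close>, take averages of
  \<open>g\<close> over consecutive blocks ending at \<open>k n = (n + 1)! - 1\<close>. As \<open>k n\<close> is negligible compared
  to \<open>k (n + 1)\<close>, these averages are asymptotic in norm to a subsequence of the Cesaro means of
  \<open>g\<close>, and they form a convex block subsequence of the original sequence.
\<close>

section \<open>Pointwise null sequences and Cesaro means, for the upper bound\<close>

lemma weak_star_null_pointwise:
  assumes "weak_star_null smul f"
  shows "(\<lambda>n. blinfun_apply (f n) x) \<longlonglongrightarrow> 0"
proof (rule topological_tendstoI)
  fix U :: "'a set" assume U: "open U" "0 \<in> U"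
  let ?V = "{f \<in> dual smul. blinfun_apply f x \<in> U}"
  have "openin (weak_star_topology smul) ?V"
    unfolding weak_star_topology_def using U by (intro topology_generated_by_Basis) blast
  moreover have "0 \<in> ?V" using U by (simp add: dual_def)
  ultimately have "\<forall>\<^sub>F n in sequentially. f n \<in> ?V"
    using assms unfolding weak_star_null_def limitin_def by blast
  then show "\<forall>\<^sub>F n in sequentially. blinfun_apply (f n) x \<in> U"
    by (rule eventually_mono) simp
qed

lemma cesaro_tendsto_zero:
  fixes x :: "nat \<Rightarrow> 'b::real_normed_vector"
  assumes "x \<longlonglongrightarrow> 0"
  shows "cesaro x \<longlonglongrightarrow> 0"
proof (rule LIMSEQ_I)
  fix e :: real assume e: "e > 0"
  obtain N where N: "\<And>n. n \<ge> N \<Longrightarrow> norm (x n) < e / 2"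
    using LIMSEQ_D[OF assms, of "e / 2"] e by auto
  \<comment> \<open>\<open>C\<close> bounds the contribution of the finitely many terms that may be
    large. Its share of the mean is \<open>C / real (Suc n)\<close>, which vanishes, while the
    remaining terms average to at most \<open>e / 2\<close>.\<close>
  define C where "C = (\<Sum>i<N. norm (x i))"
  have "(\<lambda>n. C / real (Suc n)) \<longlonglongrightarrow> 0"
    by (rule LIMSEQ_Suc[OF lim_const_over_n])
  from LIMSEQ_D[OF this, of "e / 2"] e obtain M
    where M: "\<And>n. n \<ge> M \<Longrightarrow> norm (C / real (Suc n)) < e / 2" by auto
  have "norm (cesaro x n - 0) < e" if n: "n \<ge> max M N" for n
  proof -
    have split: "{..n} = {..<N} \<union> {N..n}" using n by auto
    have "norm (\<Sum>i\<le>n. x i) \<le> (\<Sum>i\<le>n. norm (x i))" by (rule norm_sum)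
    also have "\<dots> = C + (\<Sum>i\<in>{N..n}. norm (x i))"
      unfolding C_def split by (rule sum.union_disjoint) auto
    also have "(\<Sum>i\<in>{N..n}. norm (x i)) \<le> (\<Sum>i\<in>{N..n}. e / 2)"
      using N by (intro sum_mono) (auto intro: less_imp_le)
    also have "\<dots> \<le> real (Suc n) * (e / 2)"
      unfolding sum_constant using e by (intro mult_right_mono) auto
    finally have "norm (\<Sum>i\<le>n. x i) / real (Suc n) \<le> (C + real (Suc n) * (e / 2)) / real (Suc n)"
      by (intro divide_right_mono) auto
    also have "\<dots> = C / real (Suc n) + e / 2" by (simp add: field_simps)
    also have "C / real (Suc n) < e / 2" using M[of n] n abs_ge_self[of "C / real (Suc n)"]
      unfolding real_norm_def by linarith
    also have "e / 2 + e / 2 = e" by simp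
    finally show ?thesis by (simp add: cesaro_def)
  qed
  then show "\<exists>no. \<forall>n\<ge>no. norm (cesaro x n - 0) < e" by blast
qed

lemma blinfun_apply_cesaro:
  "blinfun_apply (cesaro f n) x = cesaro (\<lambda>i. blinfun_apply (f i) x) n"
  by (simp add: cesaro_def blinfun.bilinear_simps blinfun.sum_left)

lemma alpha_le_ca:
  assumes "\<And>x. (\<lambda>n. blinfun_apply (f n) x) \<longlonglongrightarrow> 0"
  shows "alpha smul f \<le> ca f"
  unfolding alpha_def
proof (rule SUP_least)
  fix K assume "K \<in> weakly_compact_subsets smul"
  then have K: "norm x \<le> 1" if "x \<in> K" for x
    using that by (auto simp: weakly_compact_subsets_def)
  show "limsup (\<lambda>n. SUP x\<in>K. ennreal (norm (blinfun_apply (f n) x))) \<le> ca f"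
    unfolding ca_def limsup_INF_SUP
  \<comment> \<open>Both sides are now infima over the starting index of a tail, so they are
    compared tail by tail with the same \<open>N\<close>.\<close>
  proof (intro INF_mono bexI SUP_least)
    fix N n :: nat and x assume n: "n \<in> {N..}" and x: "x \<in> K"
    let ?B = "SUP k\<in>{N..}. SUP l\<in>{N..}. ennreal (norm (f k - f l))"
    have lim: "(\<lambda>m. ennreal (norm (blinfun_apply (f n) x - blinfun_apply (f m) x)))
        \<longlonglongrightarrow> ennreal (norm (blinfun_apply (f n) x - 0))"
      by (intro tendsto_intros assms)
    have "ennreal (norm (blinfun_apply (f n) x - blinfun_apply (f m) x)) \<le> ?B"
      if "m \<ge> N" for m
    proof -
      have "norm (blinfun_apply (f n) x - blinfun_apply (f m) x) \<le> norm (f n - f m) * norm x"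
        by (metis blinfun.diff_left norm_blinfun)
      also have "\<dots> \<le> norm (f n - f m)" using K[OF x] by (simp add: mult_left_le)
      finally have "ennreal (norm (blinfun_apply (f n) x - blinfun_apply (f m) x))
          \<le> ennreal (norm (f n - f m))" by (rule ennreal_leI)
      also have "\<dots> \<le> ?B" using n that by (intro SUP_upper2[of n] SUP_upper) auto
      finally show ?thesis .
    qed
    \<comment> \<open>Here \<open>n\<close> is fixed and \<open>m\<close> tends to infinity. The
      bound holds from \<open>m = N\<close> on, so it passes to the limit, where
      \<open>blinfun_apply (f m) x\<close> disappears.\<close>
    then have "ennreal (norm (blinfun_apply (f n) x - 0)) \<le> ?B"
      by (intro Lim_bounded[OF lim, of N]) blast
    then show "ennreal (norm (blinfun_apply (f n) x)) \<le> ?B" by simp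
  qed auto
qed

section \<open>Norm perturbations and block averages, for the lower bound\<close>

lemma ennreal_limsup_add_mono:
  fixes u v :: "nat \<Rightarrow> ennreal"
  shows "limsup (\<lambda>n. u n + v n) \<le> limsup u + limsup v"
  including ennreal.lifting by transfer (rule ereal_limsup_add_mono)

text \<open>Since \<open>K\<close> lies in the unit ball, a perturbation of a functional changes its
  supremum over \<open>K\<close> by at most the norm of the perturbation, so a norm-null
  perturbation leaves the limsup unchanged. Passing to the indices \<open>s n\<close> can only lower
  it.\<close>

lemma alpha_le_of_asymptotic_subsequence:
  assumes s: "strict_mono s" and lim: "(\<lambda>n. norm (f n - g (s n))) \<longlonglongrightarrow> 0"
  shows "alpha smul f \<le> alpha smul g"
  unfolding alpha_def
proof (rule SUP_mono, rule bexI)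
  fix K assume Kw: "K \<in> weakly_compact_subsets smul"
  then have K: "norm x \<le> 1" if "x \<in> K" for x
    using that by (auto simp: weakly_compact_subsets_def)
  let ?a = "\<lambda>h. SUP x\<in>K. ennreal (norm (blinfun_apply h x))"
  have "?a (f n) \<le> ennreal (norm (f n - g (s n))) + ?a (g (s n))" for n
  proof (rule SUP_least)
    fix x assume x: "x \<in> K"
    have "norm (blinfun_apply (f n) x)
        \<le> norm (blinfun_apply (f n - g (s n)) x) + norm (blinfun_apply (g (s n)) x)"
      by (metis blinfun.diff_left diff_add_cancel norm_triangle_ineq)
    also have "norm (blinfun_apply (f n - g (s n)) x) \<le> norm (f n - g (s n)) * norm x"
      by (rule norm_blinfun)
    also have "\<dots> \<le> norm (f n - g (s n))" using K[OF x] by (simp add: mult_left_le)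
    finally have "ennreal (norm (blinfun_apply (f n) x))
        \<le> ennreal (norm (f n - g (s n)) + norm (blinfun_apply (g (s n)) x))"
      by (simp add: ennreal_leI del: ennreal_plus)
    also have "\<dots> = ennreal (norm (f n - g (s n))) + ennreal (norm (blinfun_apply (g (s n)) x))"
      by simp
    also have "\<dots> \<le> ennreal (norm (f n - g (s n))) + ?a (g (s n))"
      using x by (intro add_left_mono SUP_upper)
    finally show "ennreal (norm (blinfun_apply (f n) x)) \<le> \<dots>" .
  qed
  then have "limsup (\<lambda>n. ?a (f n))
      \<le> limsup (\<lambda>n. ennreal (norm (f n - g (s n))) + ?a (g (s n)))"
    by (intro Limsup_mono always_eventually) auto
  also have "\<dots> \<le> limsup (\<lambda>n. ennreal (norm (f n - g (s n)))) + limsup (\<lambda>n. ?a (g (s n)))"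
    by (rule ennreal_limsup_add_mono)
  also have "limsup (\<lambda>n. ennreal (norm (f n - g (s n)))) = 0"
    using tendsto_ennrealI[OF lim] by (intro lim_imp_Limsup) auto
  also have "0 + limsup (\<lambda>n. ?a (g (s n))) = limsup (\<lambda>n. ?a (g (s n)))" by simp
  also have "\<dots> \<le> limsup (\<lambda>n. ?a (g n))"
    using limsup_subseq_mono[OF s, of "\<lambda>n. ?a (g n)"] by (simp add: comp_def)
  finally show "limsup (\<lambda>n. ?a (f n)) \<le> limsup (\<lambda>n. ?a (g n))" .
qed

text \<open>Let \<open>S\<close> and \<open>A\<close> be the sums of the first \<open>n\<close> and
  the first \<open>m\<close> terms. The block sum is \<open>S - A\<close>, and collecting the
  multiples of \<open>S\<close> leaves two terms. As \<open>norm S \<le> real n\<close> and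
  \<open>norm A \<le> real m\<close>, each has norm at most \<open>m / (n - m)\<close>, whence the
  factor 2.\<close>

lemma block_average_close_to_mean:
  fixes x :: "nat \<Rightarrow> 'b::real_normed_vector"
  assumes bound: "\<And>i. norm (x i) \<le> 1" and "m < n"
  shows "norm ((1 / real (n - m)) *\<^sub>R (\<Sum>i=m..<n. x i) - (1 / real n) *\<^sub>R (\<Sum>i<n. x i))
      \<le> 2 * real m / real (n - m)"
proof -
  have alg: "a *\<^sub>R (u - v) - b *\<^sub>R u = (a - b) *\<^sub>R u - a *\<^sub>R v" for a b and u v :: 'b
    by (simp add: algebra_simps)
  define A where "A = (\<Sum>i<m. x i)"
  define S where "S = (\<Sum>i<n. x i)"
  have "(\<Sum>i=m..<n. x i) = S - A"
    using \<open>m < n\<close> sum_diff_nat_ivl[of 0 m n x] by (simp add: A_def S_def lessThan_atLeast0)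
  moreover have "norm A \<le> real m" "norm S \<le> real n"
    unfolding A_def S_def using bound sum_norm_le[of "{..<m}" x "\<lambda>_. 1"]
      sum_norm_le[of "{..<n}" x "\<lambda>_. 1"] by simp_all
  moreover have "1 / real (n - m) - 1 / real n = real m / (real (n - m) * real n)"
    using \<open>m < n\<close> by (simp add: field_simps of_nat_diff)
  then have "(1 / real (n - m)) *\<^sub>R (S - A) - (1 / real n) *\<^sub>R S
      = (real m / (real (n - m) * real n)) *\<^sub>R S - (1 / real (n - m)) *\<^sub>R A"
    by (simp add: alg)
  moreover have "norm \<dots> \<le> norm ((real m / (real (n - m) * real n)) *\<^sub>R S)
      + norm ((1 / real (n - m)) *\<^sub>R A)"
    by (rule norm_triangle_ineq4)
  moreover have "norm ((real m / (real (n - m) * real n)) *\<^sub>R S)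
      \<le> (real m / (real (n - m) * real n)) * real n"
    using \<open>norm S \<le> real n\<close> unfolding norm_scaleR by (intro mult_mono) auto
  moreover have "\<dots> = real m / real (n - m)" using \<open>m < n\<close> by simp
  moreover have "norm ((1 / real (n - m)) *\<^sub>R A) \<le> real m / real (n - m)"
    using \<open>norm A \<le> real m\<close> by (simp add: divide_right_mono)
  ultimately show ?thesis by (simp add: S_def)
qed

lemma block_average_in_convex_hull:
  fixes x :: "nat \<Rightarrow> 'b::real_vector"
  assumes "m < n"
  shows "(1 / real (n - m)) *\<^sub>R (\<Sum>i=m..<n. x i) \<in> convex hull (x ` {m..<n})"
proof -
  have "(\<Sum>i=m..<n. (1 / real (n - m)) *\<^sub>R x i) \<in> convex hull (x ` {m..<n})"
    using assms by (intro convex_sum) (auto intro: hull_inc)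
  then show ?thesis by (simp add: scaleR_sum_right)
qed

text \<open>A block of \<open>g\<close> is carried by \<open>r\<close> into an interval of indices
  of \<open>f\<close>. Enlarging the images to full intervals gives consecutive blocks, and the
  convex hulls only grow.\<close>

lemma convex_block_subsequences_of_subsequence:
  assumes "g \<in> subsequences f"
  shows "convex_block_subsequences g \<subseteq> convex_block_subsequences f"
proof
  fix y assume "y \<in> convex_block_subsequences g"
  then obtain k where k: "strict_mono k" "k 0 = 0"
    and y: "\<And>n. y n \<in> convex hull (g ` {k n..<k (Suc n)})"
    unfolding convex_block_subsequences_def by blast
  obtain r where r: "strict_mono r" and g: "g = f \<circ> r"
    using assms unfolding subsequences_def by blast
  \<comment> \<open>The endpoints must start at 0, whereas \<open>r (k 0) = r 0\<close> may be
    positive. The first block therefore also takes in the terms of \<open>f\<close> that precede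
    index \<open>r 0\<close>.\<close>
  define l where "l n = (if n = 0 then 0 else r (k n))" for n
  have kS: "k n < k (Suc n)" for n using k(1) by (simp add: strict_mono_Suc_iff)
  have rk: "r (k n) < r (k (Suc n))" for n using r kS by (simp add: strict_mono_less)
  have "strict_mono l"
    unfolding strict_mono_Suc_iff l_def using rk by (auto intro: le_less_trans[OF le0])
  moreover have "y n \<in> convex hull (f ` {l n..<l (Suc n)})" for n
  proof -
    have "r ` {k n..<k (Suc n)} \<subseteq> {l n..<l (Suc n)}"
      using r by (auto simp: l_def strict_mono_less strict_mono_less_eq)
    then have "g ` {k n..<k (Suc n)} \<subseteq> f ` {l n..<l (Suc n)}"
      unfolding g image_comp[symmetric] by (rule image_mono)
    from hull_mono[OF this] y show ?thesis by blast
  qed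
  ultimately show "y \<in> convex_block_subsequences f"
    unfolding convex_block_subsequences_def by (auto intro!: exI[of _ l] simp: l_def)
qed

lemma ex_convex_block_subsequence_alpha_le_c_alpha:
  assumes "\<And>i. norm (g i) \<le> 1"
  shows "\<exists>y\<in>convex_block_subsequences g. alpha smul y \<le> c_alpha smul g"
proof -
  \<comment> \<open>Subtracting 1 makes \<open>k 0 = 0\<close>. The block length is then (n + 2)! -
    (n + 1)! = (n + 1) (n + 1)!, that is \<open>Suc n * Suc (k n)\<close>, so the bound 2 m / (n -
    m) for block averages becomes at most \<open>2 / real (Suc n)\<close>.\<close>
  define k :: "nat \<Rightarrow> nat" where "k n = fact (Suc n) - 1" for n
  define y where "y n = (1 / real (k (Suc n) - k n)) *\<^sub>R (\<Sum>i=k n..<k (Suc n). g i)" for n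
  have fact1: "1 \<le> (fact n :: nat)" for n by (rule fact_ge_1)
  have gap: "k (Suc n) - k n = Suc n * Suc (k n)" for n
    using fact1[of "Suc n"] by (simp add: k_def algebra_simps)
  have kS: "k n < k (Suc n)" for n
    using gap[of n] by (metis less_imp_Suc_add mult_pos_pos zero_less_Suc zero_less_diff)
  have k: "strict_mono k" "k 0 = 0" using kS by (simp_all add: strict_mono_Suc_iff k_def)
  have "y \<in> convex_block_subsequences g"
    unfolding convex_block_subsequences_def y_def
    using k block_average_in_convex_hull[OF kS] by blast
  moreover have "alpha smul y \<le> alpha smul (cesaro g)"
  proof (rule alpha_le_of_asymptotic_subsequence)
    \<comment> \<open>\<open>cesaro g j\<close> averages \<open>j + 1\<close> terms, so the mean of
      the first \<open>k (Suc n)\<close> terms has index \<open>k (Suc n) - 1\<close>. The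
      subtraction is exact because \<open>k (Suc n)\<close> is positive.\<close>
    let ?s = "\<lambda>n. k (Suc n) - 1"
    show "strict_mono ?s"
      unfolding strict_mono_Suc_iff using kS by (metis diff_less_mono le_simps(2) less_one not_less0 not_less)
    show "(\<lambda>n. norm (y n - cesaro g (?s n))) \<longlonglongrightarrow> 0"
    proof (rule tendsto_sandwich[where f = "\<lambda>_. 0"])
      show "(\<lambda>n. 2 / real (Suc n)) \<longlonglongrightarrow> 0" by (rule LIMSEQ_Suc[OF lim_const_over_n])
      have "norm (y n - cesaro g (?s n)) \<le> 2 / real (Suc n)" for n
      proof -
        have pos: "Suc (?s n) = k (Suc n)" using kS[of n] by simp
        then have "{..?s n} = {..<k (Suc n)}" by (metis lessThan_Suc_atMost)
        then have "cesaro g (?s n) = (1 / real (k (Suc n))) *\<^sub>R (\<Sum>i<k (Suc n). g i)"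
          unfolding cesaro_def pos by simp
        then have "norm (y n - cesaro g (?s n)) \<le> 2 * real (k n) / real (k (Suc n) - k n)"
          unfolding y_def using block_average_close_to_mean[OF assms kS] by simp
        also have "\<dots> = (2 / real (Suc n)) * (real (k n) / real (Suc (k n)))"
          unfolding gap by (simp only: of_nat_mult) simp
        also have "\<dots> \<le> 2 / real (Suc n)" by (intro mult_left_le) auto
        finally show ?thesis .
      qed
      then show "\<forall>\<^sub>F n in sequentially. norm (y n - cesaro g (?s n)) \<le> 2 / real (Suc n)"
        by (rule always_eventually[OF allI])
    qed auto
  qed
  ultimately show ?thesis unfolding c_alpha_def by blast
qed

section \<open>The two inequalities\<close>

lemma K1_le_mu_s: "K1 smul \<le> mu_s smul"
  unfolding K1_def mu_s_def
proof (intro SUP_mono bexI INF_greatest)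
  fix f g assume f: "f \<in> weak_star_null_seqs smul" and g: "g \<in> subsequences f"
  have "norm (g i) \<le> 1" for i
    using f g by (auto simp: weak_star_null_seqs_def subsequences_def image_subset_iff)
  then obtain y where y: "y \<in> convex_block_subsequences g" "alpha smul y \<le> c_alpha smul g"
    using ex_convex_block_subsequence_alpha_le_c_alpha by blast
  \<comment> \<open>Among the subsequences \<open>h\<close> of \<open>g\<close>, the choice
    \<open>h = g\<close> already gives a large enough value: \<open>y\<close> is built from the
    Cesaro means of \<open>g\<close> itself.\<close>
  have "g \<in> subsequences g"
    unfolding subsequences_def by (auto intro!: exI[of _ id] simp: strict_mono_id)
  then have "c_alpha smul g \<le> (SUP h\<in>subsequences g. c_alpha smul h)" by (rule SUP_upper)
  with y convex_block_subsequences_of_subsequence[OF g]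
  show "(INF y\<in>convex_block_subsequences f. alpha smul y) \<le> (SUP h\<in>subsequences g. c_alpha smul h)"
    by (meson INF_lower2 order_trans subsetD)
qed

text \<open>A weak* null sequence in the dual ball is one of the competitors in \<open>bs\<close>,
  so the same \<open>f\<close>, \<open>g\<close> and \<open>h\<close> serve on both sides. Pointwise
  convergence to 0 passes from \<open>f\<close> to \<open>h\<close> and to its Cesaro means, where
  the oscillation bound \<open>alpha_le_ca\<close> applies.\<close>

lemma mu_s_le_bs: "mu_s smul \<le> bs (dual smul)"
  unfolding mu_s_def bs_def
proof (rule SUP_mono, rule bexI, rule INF_mono, rule bexI)
  fix f g assume f: "f \<in> weak_star_null_seqs smul" and g: "g \<in> subsequences f"
  show "(SUP h\<in>subsequences g. c_alpha smul h) \<le> (SUP h\<in>subsequences g. cca h)"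
  proof (intro SUP_mono bexI)
    fix h assume "h \<in> subsequences g"
    then obtain q where q: "strict_mono q" "h = g \<circ> q"
      unfolding subsequences_def by blast
    obtain p where p: "strict_mono p" "g = f \<circ> p"
      using g unfolding subsequences_def by blast
    define r where "r = p \<circ> q"
    have r: "strict_mono r" and h: "h = f \<circ> r"
      using p q by (simp_all add: r_def strict_mono_o comp_assoc)
    have "(\<lambda>n. blinfun_apply (cesaro h n) x) \<longlonglongrightarrow> 0" for x
    proof -
      have "(\<lambda>n. blinfun_apply (f n) x) \<longlonglongrightarrow> 0"
        using f by (intro weak_star_null_pointwise[of smul]) (simp add: weak_star_null_seqs_def)
      from LIMSEQ_subseq_LIMSEQ[OF this r] show ?thesis
        unfolding blinfun_apply_cesaro h by (intro cesaro_tendsto_zero) (simp add: comp_def)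
    qed
    then show "c_alpha smul h \<le> cca h"
      unfolding c_alpha_def cca_def by (rule alpha_le_ca)
  qed
qed (auto simp: weak_star_null_seqs_def)

theorem theorem5p4:
  fixes smul :: "'k::{real_normed_field,euclidean_space} \<Rightarrow> 'a::banach \<Rightarrow> 'a"
  assumes "banach_space_over smul"
    and "infinite_dimensional smul"
  shows "1 / 3 * K1 smul \<le> mu_s smul \<and> mu_s smul \<le> bs (dual smul)"
proof
  have "1 / 3 \<le> (1 :: ennreal)" by (rule divide_le_posI_ennreal) auto
  then have "1 / 3 * K1 smul \<le> 1 * K1 smul" by (rule mult_right_mono) simp
  also have "\<dots> \<le> mu_s smul" using K1_le_mu_s by simp
  finally show "1 / 3 * K1 smul \<le> mu_s smul" .
qed (rule mu_s_le_bs)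

end
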